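(* Let $f \in C^{1}(\mathbb{R})$ (with $f:\mathbb{R}\to\mathbb{R}$), and let $x^{*}\in\mathbb{R}$ satisfy $f(x^{*})=0$ and $f'(x^{*})=\lambda>0$. Let $\epsilon\in\mathbb{R}$ and $\tau>0$ verify $$\frac{e^{3\lambda\tau}-1}{\tau e^{\lambda\tau}(e^{\lambda\tau}-1)}<\epsilon<\frac{e^{3\lambda\tau}+1}{\tau e^{\lambda\tau}(e^{\lambda\tau}-1)}.$$ Then $x^{*}$ is an asymptotically stable equilibrium point of the controlled system $$\dot{x}(t)=f(x(t))+\epsilon(t)\,\bigl(x(t-2\tau)-x(t-\tau)\bigr),\qquad t\ge 0,$$ where, for $k\in\mathbb{N}\cup\{0\}$, $\epsilon(t)=0$ if $3k\tau\le t<(3k+2)\tau$ and $\epsilon(t)=\epsilon$ if $(3k+2)\tau\le t<(3k+3)\tau$.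
   Context: The controlled system is understood as a piecewise ordinary differential equation with initial condition $x(0)=x_0$ (no history on $[-2\tau,0)$ is needed, because the delayed term is switched off on $[0,2\tau)$). A solution is a continuous function $x(t)$ such that, for each $k\ge 0$: on $[3k\tau,(3k+2)\tau)$ it satisfies $\dot{x}(t)=f(x(t))$; on $[(3k+2)\tau,(3k+3)\tau)$ it satisfies $\dot{x}(t)=f(x(t))+\epsilon\,(x(t-2\tau)-x(t-\tau))$, where the delayed values are determined by the solution on the preceding subinterval $[3k\tau,(3k+2)\tau)$. Derivatives at the switching times are right derivatives. The point $x^{*}$ is an equilibrium of the controlled system, i.e. $x(t)\equiv x^{*}$ is a solution. It is asymptotically stable if (i) for every $\Delta>0$ there is $\delta>0$ such that for $|x_0-x^{*}|<\delta$ there is a unique solution with $x(0)=x_0$, it exists for all $t\ge 0$, and $|x(t)-x^{*}|<\Delta$ for all $t\ge 0$; and (ii) there is $\delta'>0$ such that $|x_0-x^{*}|<\delta'$ implies $\lim_{t\to\infty}x(t)=x^{*}$. *)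

theory Defs
  imports "HOL-Analysis.Analysis"
begin

text \<open>
  Solutions are considered on a time interval \<open>J\<close>, which is \<open>{0..<T}\<close> or \<open>{0..}\<close>;
  the values of \<open>x\<close> outside \<open>J\<close> play no role (on the phases where the delayed term is
  present, both delayed times lie in \<open>J\<close>).
  The filter \<open>at t within {a..<b} \<inter> J\<close> yields the two-sided derivative at interior times
  and the right derivative at the switching time \<open>t = a\<close>.
  The gain \<open>\<epsilon>(t)\<close> is 0 in the first clause and \<open>\<epsilon>\<close> in the second.
\<close>

definition solution_on ::
  "(real \<Rightarrow> real) \<Rightarrow> real \<Rightarrow> real \<Rightarrow> real \<Rightarrow> real set \<Rightarrow> (real \<Rightarrow> real) \<Rightarrow> bool"
where
  "solution_on f \<epsilon> \<tau> x0 J x \<longleftrightarrow>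
     continuous_on J x \<and> x 0 = x0 \<and>
     (\<forall>k::nat.
        (\<forall>t \<in> {3 * real k * \<tau> ..< (3 * real k + 2) * \<tau>} \<inter> J.
           (x has_real_derivative f (x t))
             (at t within {3 * real k * \<tau> ..< (3 * real k + 2) * \<tau>} \<inter> J)) \<and>
        (\<forall>t \<in> {(3 * real k + 2) * \<tau> ..< (3 * real k + 3) * \<tau>} \<inter> J.
           (x has_real_derivative f (x t) + \<epsilon> * (x (t - 2 * \<tau>) - x (t - \<tau>)))
             (at t within {(3 * real k + 2) * \<tau> ..< (3 * real k + 3) * \<tau>} \<inter> J)))"

text \<open>Uniqueness is required among all solutions, including those defined only on a
  bounded interval \<open>{0..<T}\<close>; it covers the solutions on \<open>{0..}\<close> by restriction.\<close>

definition unique_global_solution ::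
  "(real \<Rightarrow> real) \<Rightarrow> real \<Rightarrow> real \<Rightarrow> real \<Rightarrow> (real \<Rightarrow> real) \<Rightarrow> bool"
where
  "unique_global_solution f \<epsilon> \<tau> x0 x \<longleftrightarrow>
     solution_on f \<epsilon> \<tau> x0 {0..} x \<and>
     (\<forall>T>0. \<forall>y. solution_on f \<epsilon> \<tau> x0 {0..<T} y \<longrightarrow> (\<forall>t\<in>{0..<T}. y t = x t))"

definition equilibrium :: "(real \<Rightarrow> real) \<Rightarrow> real \<Rightarrow> real \<Rightarrow> real \<Rightarrow> bool" where
  "equilibrium f \<epsilon> \<tau> xs \<longleftrightarrow> solution_on f \<epsilon> \<tau> xs {0..} (\<lambda>_. xs)"

definition asymptotically_stable :: "(real \<Rightarrow> real) \<Rightarrow> real \<Rightarrow> real \<Rightarrow> real \<Rightarrow> bool" where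
  "asymptotically_stable f \<epsilon> \<tau> xs \<longleftrightarrow>
     (\<forall>\<Delta>>0. \<exists>\<delta>>0. \<forall>x0. \<bar>x0 - xs\<bar> < \<delta> \<longrightarrow>
        (\<exists>x. unique_global_solution f \<epsilon> \<tau> x0 x \<and> (\<forall>t\<ge>0. \<bar>x t - xs\<bar> < \<Delta>))) \<and>
     (\<exists>\<delta>'>0. \<forall>x0. \<bar>x0 - xs\<bar> < \<delta>' \<longrightarrow>
        (\<exists>x. unique_global_solution f \<epsilon> \<tau> x0 x \<and> (x \<longlongrightarrow> xs) at_top))"

end

theory Submission imports Defs begin

text \<open>
  Everything is decided by the map that sends the state at the start of a control period
  to the state \<open>3 \<tau>\<close> later. For the linearised equation \<open>u' = \<lambda> u\<close>, started at \<open>c\<close>, the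
  free phase gives \<open>exp (\<lambda> t) c\<close>, and in the controlled phase variation of constants
  integrates the forcing \<open>\<epsilon> (exp (\<lambda> (t - 2 \<tau>)) - exp (\<lambda> (t - \<tau>))) c\<close>. That forcing is itself
  a multiple of \<open>exp (\<lambda> t)\<close>, so it resonates with the growth of \<open>u\<close> and contributes a term
  linear in the elapsed time. The result is multiplication by
  \<open>m = exp (3 \<lambda> \<tau>) - \<epsilon> \<tau> exp (\<lambda> \<tau>) (exp (\<lambda> \<tau>) - 1)\<close>,
  and the two bounds on \<open>\<epsilon>\<close> say exactly that \<open>\<bar>m\<bar> < 1\<close>.

  To pass to \<open>f\<close>, write \<open>f (xs + x) = \<lambda> x + h x\<close> near the equilibrium. Since \<open>f\<close> is \<open>C\<^sup>1\<close>,
  the remainder \<open>h\<close> has a Lipschitz constant \<open>\<eta>\<close> as small as desired on a small interval, and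
  extending it by constants makes it globally Lipschitz
  (\<open>linearization_with_small_lipschitz_remainder\<close>). For such an \<open>h\<close> the equation is globally
  solvable by Picard iteration, a solution stays below \<open>C \<bar>c\<bar>\<close> during one period, and the
  period map differs from \<open>m c\<close> by at most \<open>\<eta> K \<bar>c\<bar>\<close>, where \<open>C\<close> and \<open>K\<close> do not depend on \<open>\<eta>\<close>
  (\<open>perturbed_period_map\<close>). With \<open>\<eta>\<close> small, \<open>q = \<bar>m\<bar> + \<eta> K < 1\<close>.
  If \<open>C \<bar>c\<bar>\<close> is at most the radius of the interval, the extension is never reached, the pieces
  solve the original equation, and joining them period by period gives a solution that decays
  like \<open>q ^ N\<close> (\<open>exponential_decay_near_equilibrium\<close>). Stability and attraction are both
  read off from this decay.

  Uniqueness is global: \<open>f\<close> is Lipschitz on compact intervals, and on a controlled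
  phase the delayed values are already determined, so two solutions agree phase by phase
  (\<open>solution_unique\<close>).
\<close>

section \<open>Scalar differential equations with Lipschitz right-hand side\<close>

text \<open>
  The Picard operator contracts the space of bounded continuous functions on an interval of
  any length when the sup norm is weighted by \<open>exp (- K (t - a))\<close> with \<open>K\<close> larger than the
  Lipschitz constant. Instead of changing the norm, the proof changes the unknown:
  the fixed point is \<open>z t = exp (- K (t - a)) v t\<close>.
\<close>

lemma picard_lindelof_global:
  fixes G :: "real \<Rightarrow> real \<Rightarrow> real"
  assumes ab: "a \<le> b"
    and G_cont: "continuous_on ({a..b} \<times> UNIV) (\<lambda>(t, z). G t z)"
    and G_lip: "\<And>t y z. t \<in> {a..b} \<Longrightarrow> \<bar>G t y - G t z\<bar> \<le> L * \<bar>y - z\<bar>"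
  shows "\<exists>v. v a = c \<and>
    (\<forall>t\<in>{a..b}. (v has_real_derivative G t (v t)) (at t within {a..b}))"
proof -
  define K where "K = 2 * \<bar>L\<bar> + 1"
  have K: "K > 0" "\<bar>L\<bar> / K \<le> 1/2" by (auto simp: K_def field_simps)
  \<comment> \<open>The Banach space consists of functions on all of \<open>\<real>\<close>; they are read on \<open>{a..b}\<close> through
    the retraction \<open>cl\<close>.\<close>
  define cl where "cl t = max a (min b t)" for t :: real
  have cl_in: "cl t \<in> {a..b}" for t using ab by (auto simp: cl_def)
  have cl_id: "t \<in> {a..b} \<Longrightarrow> cl t = t" for t by (auto simp: cl_def)
  have cl_cont: "continuous_on UNIV cl" unfolding cl_def by (intro continuous_intros)
  define g where "g z s = G s (exp (K * (s - a)) * z s)" for z s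
  have g_cont: "continuous_on {a..b} (g z)" if "continuous_on UNIV z" for z
  proof -
    have "continuous_on {a..b} ((\<lambda>(t, z). G t z) \<circ> (\<lambda>s. (s, exp (K * (s - a)) * z s)))"
      by (intro continuous_on_compose continuous_intros continuous_on_subset[OF that]
          continuous_on_subset[OF G_cont]) auto
    then show ?thesis by (simp add: o_def g_def)
  qed
  define P where "P z t = exp (- K * (t - a)) * (c + integral {a..t} (g z))" for z t
  have P_cont: "continuous_on {a..b} (P z)" if "continuous_on UNIV z" for z
    unfolding P_def
    by (intro continuous_intros indefinite_integral_continuous_1 integrable_continuous_real
        g_cont[OF that])
  have P_bcont: "(\<lambda>t. P (apply_bcontfun z) (cl t)) \<in> bcontfun" for z
  proof -
    have z: "continuous_on UNIV (apply_bcontfun z)" by (rule continuous_on_apply_bcontfun)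
    have 1: "continuous_on UNIV (\<lambda>t. P (apply_bcontfun z) (cl t))"
      using cl_in by (intro continuous_on_compose2[OF P_cont[OF z] cl_cont]) auto
    have "compact (P (apply_bcontfun z) ` {a..b})"
      by (intro compact_continuous_image P_cont z compact_Icc)
    then have "bounded (P (apply_bcontfun z) ` {a..b})" by (rule compact_imp_bounded)
    then have "bounded (range (\<lambda>t. P (apply_bcontfun z) (cl t)))"
      by (rule bounded_subset) (use cl_in in auto)
    with 1 show ?thesis by (simp add: bcontfun_def)
  qed
  define \<Phi> where "\<Phi> z = Bcontfun (\<lambda>t. P (apply_bcontfun z) (cl t))" for z
  have \<Phi>_apply: "apply_bcontfun (\<Phi> z) t = P (apply_bcontfun z) (cl t)" for z t
    unfolding \<Phi>_def by (simp add: Bcontfun_inverse[OF P_bcont])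
  have contr: "dist (\<Phi> y) (\<Phi> z) \<le> 1/2 * dist y z" for y z
  proof (rule dist_bound)
    fix t0
    define t where "t = cl t0"
    have t: "t \<in> {a..b}" using cl_in by (simp add: t_def)
    have yc: "continuous_on UNIV (apply_bcontfun y)" and zc: "continuous_on UNIV (apply_bcontfun z)"
      by (rule continuous_on_apply_bcontfun)+
    have sub: "{a..t} \<subseteq> {a..b}" using t by auto
    have int: "g y integrable_on {a..t}" "g z integrable_on {a..t}"
      using g_cont[OF yc] g_cont[OF zc] sub
      by (blast intro: integrable_continuous_real continuous_on_subset)+
    have prim: "((\<lambda>s. \<bar>L\<bar> * dist y z * exp (K * (s - a))) has_integral
        (\<bar>L\<bar> * dist y z * exp (K * (t - a)) / K - \<bar>L\<bar> * dist y z * exp (K * (a - a)) / K)) {a..t}"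
      using t K
      by (intro fundamental_theorem_of_calculus)
         (auto simp flip: has_real_derivative_iff_has_vector_derivative intro!: derivative_eq_intros)
    have "norm (integral {a..t} (\<lambda>s. g y s - g z s))
        \<le> integral {a..t} (\<lambda>s. \<bar>L\<bar> * dist y z * exp (K * (s - a)))"
    proof (rule integral_norm_bound_integral)
      show "(\<lambda>s. g y s - g z s) integrable_on {a..t}" using int by (rule integrable_diff)
      show "(\<lambda>s. \<bar>L\<bar> * dist y z * exp (K * (s - a))) integrable_on {a..t}"
        using prim by blast
      fix s assume s: "s \<in> {a..t}"
      have "\<bar>g y s - g z s\<bar> \<le> L * \<bar>exp (K * (s - a)) * y s - exp (K * (s - a)) * z s\<bar>"
        unfolding g_def using s sub by (intro G_lip) auto
      also have "\<dots> = L * (exp (K * (s - a)) * \<bar>y s - z s\<bar>)"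
        by (simp flip: right_diff_distrib add: abs_mult)
      also have "\<dots> \<le> \<bar>L\<bar> * (exp (K * (s - a)) * dist y z)"
        using dist_bounded[of y s z] by (intro mult_mono) (auto simp: dist_real_def)
      finally show "norm (g y s - g z s) \<le> \<bar>L\<bar> * dist y z * exp (K * (s - a))"
        by (simp add: algebra_simps)
    qed
    also have "\<dots> \<le> \<bar>L\<bar> / K * dist y z * exp (K * (t - a))"
      unfolding integral_unique[OF prim] using K(1) by simp
    also have "\<dots> \<le> 1/2 * dist y z * exp (K * (t - a))"
      using K(2) by (intro mult_right_mono) auto
    finally have est: "\<bar>integral {a..t} (g y) - integral {a..t} (g z)\<bar>
        \<le> 1/2 * dist y z * exp (K * (t - a))"
      using int by (simp add: integral_diff)
    have "\<bar>P y t - P z t\<bar> =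
        exp (- K * (t - a)) * \<bar>integral {a..t} (g y) - integral {a..t} (g z)\<bar>"
      unfolding P_def by (simp flip: right_diff_distrib add: abs_mult)
    also have "\<dots> \<le> exp (- K * (t - a)) * (1/2 * dist y z * exp (K * (t - a)))"
      using est by (intro mult_left_mono) auto
    also have "\<dots> = 1/2 * dist y z" by (simp add: exp_minus)
    finally show "dist (\<Phi> y t0) (\<Phi> z t0) \<le> 1/2 * dist y z"
      by (simp add: \<Phi>_apply dist_real_def t_def)
  qed
  obtain z where z: "\<Phi> z = z"
    using banach_fix_type[of "1/2" \<Phi>] contr by auto
  define v where "v t = exp (K * (t - a)) * z t" for t
  have zc: "continuous_on UNIV (apply_bcontfun z)" by (rule continuous_on_apply_bcontfun)
  have v_eq: "v t = c + integral {a..t} (g z)" if "t \<in> {a..b}" for t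
  proof -
    have "z t = P z t" using \<Phi>_apply[of z t] z cl_id[OF that] by simp
    then show ?thesis by (simp add: v_def P_def exp_minus)
  qed
  have "(v has_real_derivative G t (v t)) (at t within {a..b})" if t: "t \<in> {a..b}" for t
  proof -
    have "((\<lambda>t. c + integral {a..t} (g z)) has_real_derivative g z t) (at t within {a..b})"
      using integral_has_real_derivative[OF g_cont[OF zc] t]
      by (auto intro!: derivative_eq_intros)
    then have "(v has_real_derivative g z t) (at t within {a..b})"
      by (rule has_field_derivative_transform_within[where d=1]) (use t v_eq in auto)
    then show ?thesis by (simp add: g_def v_def)
  qed
  moreover have "v a = c" using v_eq[of a] ab by simp
  ultimately show ?thesis by blast
qed

text \<open>
  The function \<open>exp (- lam (t - a)) w t\<close> has derivative \<open>exp (- lam (t - a)) r t\<close>, which is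
  bounded by \<open>R\<close>, and the mean value inequality applies. The estimates for the period map use it twice:
  with \<open>w\<close> a solution it bounds its size, with \<open>w\<close> the difference of a solution and its
  linearisation it bounds the linearisation error.
\<close>

lemma linear_comparison:
  fixes w r :: "real \<Rightarrow> real"
  assumes "0 \<le> lam"
    and deriv: "\<And>t. t \<in> {a..b} \<Longrightarrow>
      (w has_real_derivative lam * w t + r t) (at t within {a..b})"
    and r: "\<And>t. t \<in> {a..b} \<Longrightarrow> \<bar>r t\<bar> \<le> R"
    and t: "t \<in> {a..b}"
  shows "\<bar>w t\<bar> \<le> exp (lam * (t - a)) * (\<bar>w a\<bar> + R * (t - a))"
proof -
  define z where "z s = exp (- lam * (s - a)) * w s" for s
  have "(z has_real_derivative exp (- lam * (s - a)) * r s) (at s within {a..b})"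
    if "s \<in> {a..b}" for s
    unfolding z_def
    by (rule derivative_eq_intros deriv[OF that] refl)+ (simp add: algebra_simps)
  moreover have "norm (exp (- lam * (s - a)) * r s) \<le> R" if s: "s \<in> {a..b}" for s
  proof -
    have "exp (- lam * (s - a)) \<le> 1" using s \<open>0 \<le> lam\<close> by simp
    then have "exp (- lam * (s - a)) * \<bar>r s\<bar> \<le> 1 * \<bar>r s\<bar>" by (intro mult_right_mono) auto
    then show ?thesis using r[OF s] by (simp add: abs_mult)
  qed
  ultimately have "norm (z t - z a) \<le> R * norm (t - a)"
    using t by (intro field_differentiable_bound[of "{a..b}" z]) auto
  then have "\<bar>z t\<bar> \<le> \<bar>w a\<bar> + R * (t - a)" using t by (simp add: z_def)
  moreover have "\<bar>w t\<bar> = exp (lam * (t - a)) * \<bar>z t\<bar>"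
    by (simp add: z_def abs_mult exp_minus)
  ultimately show ?thesis by (simp add: mult_left_mono)
qed

text \<open>
  At a point where \<open>\<bar>v\<bar>\<close> is maximal, \<open>linear_comparison\<close> bounds the maximum by the data plus
  at most half of the maximum itself, which can then be absorbed into the left-hand side.
\<close>

lemma perturbed_linear_bound:
  fixes v p h :: "real \<Rightarrow> real"
  assumes "0 \<le> lam" "0 \<le> \<eta>" "a \<le> b"
    and deriv: "\<And>t. t \<in> {a..b} \<Longrightarrow>
      (v has_real_derivative lam * v t + h (v t) + p t) (at t within {a..b})"
    and h: "\<And>x. \<bar>h x\<bar> \<le> \<eta> * \<bar>x\<bar>"
    and p: "\<And>t. t \<in> {a..b} \<Longrightarrow> \<bar>p t\<bar> \<le> P"
    and small: "\<eta> * (b - a) * exp (lam * (b - a)) \<le> 1/2"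
    and t: "t \<in> {a..b}"
  shows "\<bar>v t\<bar> \<le> 2 * exp (lam * (b - a)) * (\<bar>v a\<bar> + P * (b - a))"
proof -
  have "continuous_on {a..b} v" by (rule DERIV_continuous_on) (rule deriv)
  then have "continuous_on {a..b} (\<lambda>t. \<bar>v t\<bar>)" by (intro continuous_intros)
  then obtain s where s: "s \<in> {a..b}" and smax: "\<And>t. t \<in> {a..b} \<Longrightarrow> \<bar>v t\<bar> \<le> \<bar>v s\<bar>"
    using continuous_attains_sup[of "{a..b}" "\<lambda>t. \<bar>v t\<bar>"] \<open>a \<le> b\<close> by auto
  have P0: "0 \<le> P" using p[OF s] by linarith
  have "\<bar>h (v u) + p u\<bar> \<le> \<eta> * \<bar>v s\<bar> + P" if u: "u \<in> {a..b}" for u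
    using h[of "v u"] p[OF u] mult_left_mono[OF smax[OF u] \<open>0 \<le> \<eta>\<close>] by linarith
  then have "\<bar>v s\<bar> \<le> exp (lam * (s - a)) * (\<bar>v a\<bar> + (\<eta> * \<bar>v s\<bar> + P) * (s - a))"
    using deriv s by (intro linear_comparison[OF \<open>0 \<le> lam\<close>, of a b v "\<lambda>t. h (v t) + p t"])
      (auto simp: add.assoc)
  also have "\<dots> \<le> exp (lam * (b - a)) * (\<bar>v a\<bar> + (\<eta> * \<bar>v s\<bar> + P) * (b - a))"
  proof (intro mult_mono add_left_mono)
    show "exp (lam * (s - a)) \<le> exp (lam * (b - a))"
      using s \<open>0 \<le> lam\<close> by (simp add: mult_left_mono)
  qed (use s P0 \<open>0 \<le> \<eta>\<close> in auto)
  also have "\<dots> = exp (lam * (b - a)) * (\<bar>v a\<bar> + P * (b - a))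
      + (\<eta> * (b - a) * exp (lam * (b - a))) * \<bar>v s\<bar>"
    by (simp add: algebra_simps)
  also have "\<dots> \<le> exp (lam * (b - a)) * (\<bar>v a\<bar> + P * (b - a)) + 1/2 * \<bar>v s\<bar>"
    using small by (intro add_left_mono mult_right_mono) auto
  finally have "\<bar>v s\<bar> \<le> 2 * exp (lam * (b - a)) * (\<bar>v a\<bar> + P * (b - a))" by simp
  with smax[OF t] show ?thesis by linarith
qed

lemma C1_imp_continuous_derivative:
  fixes f :: "real \<Rightarrow> real"
  assumes "f C1_differentiable_on UNIV"
  obtains D where "\<And>x. (f has_real_derivative D x) (at x)" "continuous_on UNIV D"
proof -
  obtain D where "\<forall>x\<in>UNIV. (f has_vector_derivative D x) (at x)" "continuous_on UNIV D"
    using assms unfolding C1_differentiable_on_def by blast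
  then show ?thesis
    by (intro that[of D]) (simp_all add: has_real_derivative_iff_has_vector_derivative)
qed

lemma C1_lipschitz_on_Icc:
  fixes f :: "real \<Rightarrow> real"
  assumes "f C1_differentiable_on UNIV"
  obtains L where "\<And>x y. x \<in> {lo..hi} \<Longrightarrow> y \<in> {lo..hi} \<Longrightarrow> \<bar>f x - f y\<bar> \<le> L * \<bar>x - y\<bar>"
proof -
  obtain D where D: "\<And>x. (f has_real_derivative D x) (at x)" and D_cont: "continuous_on UNIV D"
    using C1_imp_continuous_derivative[OF assms] by blast
  have "bounded (D ` {lo..hi})"
    by (rule compact_imp_bounded[OF compact_continuous_image])
       (auto intro: continuous_on_subset[OF D_cont])
  then obtain L where L: "\<And>x. x \<in> {lo..hi} \<Longrightarrow> norm (D x) \<le> L"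
    unfolding bounded_iff by blast
  have "norm (f x - f y) \<le> L * norm (x - y)" if "x \<in> {lo..hi}" "y \<in> {lo..hi}" for x y
    by (rule field_differentiable_bound[OF convex_real_interval(5) has_field_derivative_at_within[OF D] L that])
  then show ?thesis by (intro that) simp
qed

text \<open>
  On a compact interval both solutions stay in a set where \<open>f\<close> is Lipschitz with some
  constant \<open>L\<close>, so \<open>exp (- 2 L t) (y t - z t)\<^sup>2\<close> is nonincreasing; it starts at zero.
\<close>

lemma ode_unique:
  fixes f p y z :: "real \<Rightarrow> real"
  assumes f: "f C1_differentiable_on UNIV"
    and y: "\<And>t. t \<in> {a..<b} \<Longrightarrow>
      (y has_real_derivative f (y t) + p t) (at t within {a..<b})"
    and z: "\<And>t. t \<in> {a..<b} \<Longrightarrow>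
      (z has_real_derivative f (z t) + p t) (at t within {a..<b})"
    and init: "y a = z a"
    and t: "t \<in> {a..<b}"
  shows "y t = z t"
proof -
  have sub: "{a..t} \<subseteq> {a..<b}" using t by auto
  have y': "(y has_real_derivative f (y s) + p s) (at s within {a..t})"
    and z': "(z has_real_derivative f (z s) + p s) (at s within {a..t})" if "s \<in> {a..t}" for s
    using DERIV_subset[OF y sub] DERIV_subset[OF z sub] that sub by auto
  have "continuous_on {a..t} y" "continuous_on {a..t} z"
    by (rule DERIV_continuous_on, erule y', rule DERIV_continuous_on, erule z')
  then have "bounded (y ` {a..t})" "bounded (z ` {a..t})"
    by (simp_all add: compact_imp_bounded compact_continuous_image)
  then obtain B1 B2 where "\<forall>x\<in>y ` {a..t}. norm x \<le> B1" "\<forall>x\<in>z ` {a..t}. norm x \<le> B2"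
    unfolding bounded_iff by blast
  then have B: "\<bar>y s\<bar> \<le> max B1 B2 \<and> \<bar>z s\<bar> \<le> max B1 B2" if "s \<in> {a..t}" for s
    using that by (simp add: le_max_iff_disj)
  define B where "B = max B1 B2"
  note B = B[folded B_def]
  obtain L where L: "\<And>x x'. x \<in> {-B..B} \<Longrightarrow> x' \<in> {-B..B} \<Longrightarrow> \<bar>f x - f x'\<bar> \<le> L * \<bar>x - x'\<bar>"
    using C1_lipschitz_on_Icc[OF f, of "-B" B] by blast
  define E where "E s = exp (- 2 * L * s) * (y s - z s)\<^sup>2" for s
  have E': "(E has_real_derivative
      2 * exp (- 2 * L * s) * ((y s - z s) * (f (y s) - f (z s)) - L * (y s - z s)\<^sup>2))
      (at s within {a..t})" if "s \<in> {a..t}" for s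
    unfolding E_def
    by (rule derivative_eq_intros y'[OF that] z'[OF that] refl)+
       (simp add: algebra_simps power2_eq_square)
  have neg: "2 * exp (- 2 * L * s) * ((y s - z s) * (f (y s) - f (z s)) - L * (y s - z s)\<^sup>2) \<le> 0"
    if s: "s \<in> {a..t}" for s
  proof -
    have "(y s - z s) * (f (y s) - f (z s)) \<le> \<bar>y s - z s\<bar> * \<bar>f (y s) - f (z s)\<bar>"
      by (simp flip: abs_mult)
    also have "\<dots> \<le> \<bar>y s - z s\<bar> * (L * \<bar>y s - z s\<bar>)"
      using B[OF s] by (intro mult_left_mono L) auto
    also have "\<dots> = L * (y s - z s)\<^sup>2" by (simp add: power2_eq_square mult.left_commute)
    finally show ?thesis by (simp add: mult_nonneg_nonpos)
  qed
  have "E t \<le> E a"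
  proof (rule DERIV_nonpos_imp_decreasing_open[of a t E])
    show "a \<le> t" using t by simp
    show "continuous_on {a..t} E" by (rule DERIV_continuous_on) (rule E')
    fix s assume "a < s" "s < t"
    then show "\<exists>D. (E has_real_derivative D) (at s) \<and> D \<le> 0"
      using E'[of s] neg[of s] by (auto simp: at_within_Icc_at)
  qed
  also have "E a = 0" by (simp add: E_def init)
  finally have "exp (- 2 * L * t) * (y t - z t)\<^sup>2 \<le> 0" by (simp add: E_def)
  then have "(y t - z t)\<^sup>2 \<le> 0" by (simp add: mult_le_0_iff)
  then show ?thesis by simp
qed

section \<open>One period near the equilibrium\<close>

text \<open>
  A period in local time, starting at 0. The intervals are closed, so that the value at the end
  of a period is part of the solution and can serve as the initial value of the next one.
\<close>

definition period_solution ::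
  "(real \<Rightarrow> real) \<Rightarrow> real \<Rightarrow> real \<Rightarrow> (real \<Rightarrow> real) \<Rightarrow> bool"
where
  "period_solution g \<epsilon> \<tau> u \<longleftrightarrow>
     (\<forall>t \<in> {0..2 * \<tau>}. (u has_real_derivative g (u t)) (at t within {0..2 * \<tau>})) \<and>
     (\<forall>t \<in> {2 * \<tau>..3 * \<tau>}.
        (u has_real_derivative g (u t) + \<epsilon> * (u (t - 2 * \<tau>) - u (t - \<tau>)))
          (at t within {2 * \<tau>..3 * \<tau>}))"

text \<open>
  The derivative of \<open>y \<mapsto> f (xs + y) - lam y\<close> vanishes at 0 and is continuous, hence is at most
  \<open>\<eta>\<close> near 0. Composing with the retraction onto \<open>{-r..r}\<close> keeps the Lipschitz constant and makes
  the bound global, so that solutions exist and can be estimated before they are known to stay near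
  the equilibrium.
\<close>

lemma linearization_with_small_lipschitz_remainder:
  fixes f :: "real \<Rightarrow> real"
  assumes "f C1_differentiable_on UNIV" "f xs = 0" "(f has_real_derivative lam) (at xs)" "\<eta> > 0"
  obtains r h where "r > 0" "\<And>x y. \<bar>h x - h y\<bar> \<le> \<eta> * \<bar>x - y\<bar>" "h 0 = 0"
    "\<And>x. \<bar>x\<bar> \<le> r \<Longrightarrow> f (xs + x) = lam * x + h x"
proof -
  obtain D where D: "\<And>x. (f has_real_derivative D x) (at x)" and D_cont: "continuous_on UNIV D"
    using C1_imp_continuous_derivative[OF assms(1)] by blast
  have D_xs: "D xs = lam" using DERIV_unique[OF D assms(3)] .
  obtain d where d: "d > 0" and close: "\<And>x. \<bar>x - xs\<bar> < d \<Longrightarrow> \<bar>D x - lam\<bar> < \<eta>"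
    using D_cont \<open>\<eta> > 0\<close> unfolding continuous_on_iff dist_real_def D_xs[symmetric] by (metis UNIV_I)
  define r where "r = d / 2"
  have r: "r > 0" "r < d" using d by (auto simp: r_def)
  define \<phi> where "\<phi> y = f (xs + y) - lam * y" for y
  define cl where "cl y = max (-r) (min r y)" for y
  have \<phi>': "(\<phi> has_real_derivative D (xs + y) - lam) (at y within {-r..r})" for y
  proof -
    have "((\<lambda>y. f (xs + y)) has_real_derivative D (xs + y)) (at y)"
      using DERIV_shift[of f "D (xs + y)" y xs] D[of "xs + y"] by (simp add: add.commute)
    then have "(\<phi> has_real_derivative D (xs + y) - lam) (at y)"
      unfolding \<phi>_def by (auto intro!: derivative_eq_intros)
    then show ?thesis by (rule has_field_derivative_at_within)
  qed
  have \<phi>_bound: "norm (D (xs + y) - lam) \<le> \<eta>" if "y \<in> {-r..r}" for y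
  proof -
    have "\<bar>(xs + y) - xs\<bar> < d" using that r by auto
    from close[OF this] show ?thesis by simp
  qed
  have \<phi>_lip: "\<bar>\<phi> x - \<phi> y\<bar> \<le> \<eta> * \<bar>x - y\<bar>" if "x \<in> {-r..r}" "y \<in> {-r..r}" for x y
    using field_differentiable_bound[OF convex_real_interval(5) \<phi>' \<phi>_bound that] by simp
  have cl_in: "cl x \<in> {-r..r}" for x using r by (auto simp: cl_def)
  have cl_lip: "\<bar>cl x - cl y\<bar> \<le> \<bar>x - y\<bar>" for x y by (auto simp: cl_def)
  show ?thesis
  proof (rule that[of r "\<lambda>x. \<phi> (cl x)"])
    show "\<bar>\<phi> (cl x) - \<phi> (cl y)\<bar> \<le> \<eta> * \<bar>x - y\<bar>" for x y
      using \<phi>_lip[OF cl_in cl_in, of x y] mult_left_mono[OF cl_lip[of x y], of \<eta>] \<open>\<eta> > 0\<close>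
      by linarith
    show "\<phi> (cl 0) = 0" using r assms(2) by (simp add: cl_def \<phi>_def)
    show "f (xs + x) = lam * x + \<phi> (cl x)" if "\<bar>x\<bar> \<le> r" for x
    proof -
      have "cl x = x" using that by (auto simp: cl_def)
      then show ?thesis by (simp add: \<phi>_def)
    qed
  qed (rule r)
qed

lemma perturbed_linear_solution_exists:
  fixes h p :: "real \<Rightarrow> real"
  assumes "a \<le> b" and h: "\<And>x y. \<bar>h x - h y\<bar> \<le> \<eta> * \<bar>x - y\<bar>" and p: "continuous_on {a..b} p"
  obtains v where "v a = c"
    "\<And>t. t \<in> {a..b} \<Longrightarrow>
      (v has_real_derivative lam * v t + h (v t) + p t) (at t within {a..b})"
proof -
  have "\<eta>-lipschitz_on UNIV h"
  proof (rule lipschitz_onI)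
    show "0 \<le> \<eta>" using order_trans[OF abs_ge_zero h[of 1 0]] by simp
  qed (use h in \<open>simp add: dist_real_def\<close>)
  then have h_cont: "continuous_on UNIV h" by (rule lipschitz_on_continuous_on)
  have "\<exists>v. v a = c \<and> (\<forall>t\<in>{a..b}.
      (v has_real_derivative lam * v t + h (v t) + p t) (at t within {a..b}))"
  proof (rule picard_lindelof_global[where G = "\<lambda>t z. lam * z + h z + p t"])
    show "continuous_on ({a..b} \<times> UNIV) (\<lambda>(t, z). lam * z + h z + p t)"
      unfolding case_prod_unfold
      by (intro continuous_intros continuous_on_compose2[OF h_cont] continuous_on_compose2[OF p]) auto
    show "\<bar>(lam * y + h y + p t) - (lam * z + h z + p t)\<bar> \<le> (\<bar>lam\<bar> + \<eta>) * \<bar>y - z\<bar>" for t y z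
    proof -
      have "\<bar>lam * y - lam * z\<bar> = \<bar>lam\<bar> * \<bar>y - z\<bar>"
        by (simp flip: right_diff_distrib add: abs_mult)
      then show ?thesis using h[of y z] by (simp add: algebra_simps)
    qed
  qed (rule \<open>a \<le> b\<close>)
  then show ?thesis using that by blast
qed

text \<open>
  The number \<open>m\<close> is the multiplier of the period map of the linearised equation. The point of the
  statement is that \<open>C\<close> and \<open>K\<close> are chosen before \<open>\<eta>\<close>: the error \<open>\<eta> K\<close> can therefore be made
  smaller than \<open>1 - \<bar>m\<bar>\<close> afterwards.
\<close>

lemma perturbed_period_map:
  fixes lam \<tau> \<epsilon> :: real
  assumes lam: "lam > 0" and \<tau>: "\<tau> > 0"
  defines "m \<equiv> exp (3 * lam * \<tau>) - \<epsilon> * \<tau> * exp (lam * \<tau>) * (exp (lam * \<tau>) - 1)"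
  obtains C K \<eta>0 where "C > 0" "K > 0" "\<eta>0 > 0"
    "\<And>\<eta> h c. \<eta> \<le> \<eta>0 \<Longrightarrow> (\<And>x y. \<bar>h x - h y\<bar> \<le> \<eta> * \<bar>x - y\<bar>) \<Longrightarrow> h 0 = 0 \<Longrightarrow>
      \<exists>u. u 0 = c \<and> period_solution (\<lambda>x. lam * x + h x) \<epsilon> \<tau> u \<and>
        (\<forall>t\<in>{0..3 * \<tau>}. \<bar>u t\<bar> \<le> C * \<bar>c\<bar>) \<and> \<bar>u (3 * \<tau>) - m * c\<bar> \<le> \<eta> * K * \<bar>c\<bar>"
proof -
  define E where "E = exp (lam * (2 * \<tau>))"
  define e where "e = exp (lam * \<tau>)"
  have E: "1 \<le> E" and e: "1 \<le> e" "e \<le> E" using lam \<tau> by (auto simp: E_def e_def)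
  \<comment> \<open>Relative to \<open>\<bar>c\<bar>\<close>, \<open>\<eta> K1\<close> bounds the linearisation error in the free phase, \<open>\<eta> K\<close> the
    one at the end of the period, and \<open>C\<close> the size of the solution.\<close>
  define K1 where "K1 = 4 * E * E * \<tau>"
  define C where "C = 2 * E * (2 * E + 4 * \<bar>\<epsilon>\<bar> * E * \<tau>)"
  define K where "K = E * (K1 + (C + 2 * \<bar>\<epsilon>\<bar> * K1) * \<tau>)"
  have pos: "0 < K1" "0 < C" "0 < K"
    using E \<tau> by (auto simp: K1_def C_def K_def intro!: mult_pos_pos add_pos_nonneg mult_nonneg_nonneg add_nonneg_nonneg)
  have EC: "2 * E \<le> C"
  proof -
    have "2 * E * 1 \<le> 2 * E * (2 * E + 4 * \<bar>\<epsilon>\<bar> * E * \<tau>)"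
      using E \<tau> by (intro mult_left_mono) (auto intro!: add_increasing2)
    then show ?thesis by (simp add: C_def)
  qed
  have "\<exists>u. u 0 = c \<and> period_solution (\<lambda>x. lam * x + h x) \<epsilon> \<tau> u \<and>
        (\<forall>t\<in>{0..3 * \<tau>}. \<bar>u t\<bar> \<le> C * \<bar>c\<bar>) \<and> \<bar>u (3 * \<tau>) - m * c\<bar> \<le> \<eta> * K * \<bar>c\<bar>"
    if \<eta>: "\<eta> \<le> 1 / (4 * \<tau> * E)" and h_lip: "\<And>x y. \<bar>h x - h y\<bar> \<le> \<eta> * \<bar>x - y\<bar>" and h0: "h 0 = 0"
    for \<eta> c :: real and h
  proof -
    have h: "\<bar>h x\<bar> \<le> \<eta> * \<bar>x\<bar>" for x using h_lip[of x 0] h0 by simp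
    have \<eta>0: "0 \<le> \<eta>" using order_trans[OF abs_ge_zero h[of 1]] by simp
    have small: "\<eta> * (2 * \<tau>) * E \<le> 1/2" using \<eta> \<tau> E by (simp add: field_simps)
    have small': "\<eta> * \<tau> * e \<le> 1/2"
    proof -
      have "\<eta> * \<tau> * e \<le> \<eta> * (2 * \<tau>) * E"
        using \<eta>0 \<tau> e by (intro mult_mono mult_nonneg_nonneg) auto
      with small show ?thesis by simp
    qed
    obtain v where v0: "v 0 = c" and v': "\<And>t. t \<in> {0..2 * \<tau>} \<Longrightarrow>
        (v has_real_derivative lam * v t + h (v t) + 0) (at t within {0..2 * \<tau>})"
      using perturbed_linear_solution_exists[of 0 "2 * \<tau>" h \<eta> "\<lambda>_. 0" c lam] \<tau> h_lip
      by (metis continuous_on_const mult_pos_pos less_imp_le zero_less_numeral)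
    have v_cont: "continuous_on {0..2 * \<tau>} v" by (rule DERIV_continuous_on) (rule v')
    have v_bd: "\<bar>v t\<bar> \<le> 2 * E * \<bar>c\<bar>" if "t \<in> {0..2 * \<tau>}" for t
      using perturbed_linear_bound[of lam \<eta> 0 "2 * \<tau>" v h "\<lambda>_. 0" 0 t]
        lam \<tau> \<eta>0 v' h small that v0 by (simp add: E_def)
    have v_lin: "\<bar>v t - exp (lam * t) * c\<bar> \<le> \<eta> * K1 * \<bar>c\<bar>" if t: "t \<in> {0..2 * \<tau>}" for t
    proof -
      have "\<bar>v t - exp (lam * t) * c\<bar> \<le>
          exp (lam * (t - 0)) * (\<bar>v 0 - exp (lam * 0) * c\<bar> + \<eta> * (2 * E * \<bar>c\<bar>) * (t - 0))"
      proof (rule linear_comparison[where r = "\<lambda>t. h (v t)" and b = "2 * \<tau>"])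
        show "((\<lambda>t. v t - exp (lam * t) * c) has_real_derivative
            lam * (v s - exp (lam * s) * c) + h (v s)) (at s within {0..2 * \<tau>})"
          if "s \<in> {0..2 * \<tau>}" for s
          by (rule derivative_eq_intros v'[OF that] refl)+ (simp add: algebra_simps)
        show "\<bar>h (v s)\<bar> \<le> \<eta> * (2 * E * \<bar>c\<bar>)" if "s \<in> {0..2 * \<tau>}" for s
          using h[of "v s"] mult_left_mono[OF v_bd[OF that] \<eta>0] by linarith
      qed (use lam t in auto)
      also have "\<dots> = exp (lam * t) * (\<eta> * (2 * E * \<bar>c\<bar>) * t)" by (simp add: v0)
      also have "\<dots> \<le> E * (\<eta> * (2 * E * \<bar>c\<bar>) * (2 * \<tau>))"
        using t lam \<eta>0 E by (intro mult_mono mult_nonneg_nonneg) (auto simp: E_def)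
      also have "\<dots> = \<eta> * K1 * \<bar>c\<bar>" by (simp add: K1_def)
      finally show ?thesis .
    qed
    \<comment> \<open>In the controlled phase the delayed term is a known function: both delayed times lie in
      the free phase.\<close>
    define p where "p t = \<epsilon> * (v (t - 2 * \<tau>) - v (t - \<tau>))" for t
    have p_cont: "continuous_on {2 * \<tau>..3 * \<tau>} p"
      unfolding p_def by (intro continuous_intros continuous_on_compose2[OF v_cont]) auto
    have p_bd: "\<bar>p t\<bar> \<le> 4 * \<bar>\<epsilon>\<bar> * E * \<bar>c\<bar>" if "t \<in> {2 * \<tau>..3 * \<tau>}" for t
    proof -
      have "\<bar>v (t - 2 * \<tau>) - v (t - \<tau>)\<bar> \<le> 4 * E * \<bar>c\<bar>"
        using v_bd[of "t - 2 * \<tau>"] v_bd[of "t - \<tau>"] that \<tau> by auto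
      then have "\<bar>\<epsilon>\<bar> * \<bar>v (t - 2 * \<tau>) - v (t - \<tau>)\<bar> \<le> \<bar>\<epsilon>\<bar> * (4 * E * \<bar>c\<bar>)"
        by (rule mult_left_mono) simp
      then show ?thesis by (simp add: p_def abs_mult)
    qed
    obtain w where w0: "w (2 * \<tau>) = v (2 * \<tau>)" and w': "\<And>t. t \<in> {2 * \<tau>..3 * \<tau>} \<Longrightarrow>
        (w has_real_derivative lam * w t + h (w t) + p t) (at t within {2 * \<tau>..3 * \<tau>})"
      using perturbed_linear_solution_exists[of "2 * \<tau>" "3 * \<tau>" h \<eta> p "v (2 * \<tau>)" lam] \<tau> h_lip p_cont
      by auto
    have w_bd: "\<bar>w t\<bar> \<le> C * \<bar>c\<bar>" if t: "t \<in> {2 * \<tau>..3 * \<tau>}" for t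
    proof -
      have "\<bar>w t\<bar> \<le> 2 * exp (lam * (3 * \<tau> - 2 * \<tau>)) *
          (\<bar>w (2 * \<tau>)\<bar> + 4 * \<bar>\<epsilon>\<bar> * E * \<bar>c\<bar> * (3 * \<tau> - 2 * \<tau>))"
        using lam \<tau> \<eta>0 w' h p_bd small' t
        by (intro perturbed_linear_bound[of lam \<eta> "2 * \<tau>" "3 * \<tau>" w h p]) (auto simp: e_def)
      also have "\<dots> = 2 * e * (\<bar>w (2 * \<tau>)\<bar> + 4 * \<bar>\<epsilon>\<bar> * E * \<bar>c\<bar> * \<tau>)" by (simp add: e_def)
      also have "\<dots> \<le> 2 * E * (2 * E * \<bar>c\<bar> + 4 * \<bar>\<epsilon>\<bar> * E * \<bar>c\<bar> * \<tau>)"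
        using e E v_bd[of "2 * \<tau>"] \<tau> w0 by (intro mult_mono add_mono) auto
      also have "\<dots> = C * \<bar>c\<bar>" by (simp add: C_def algebra_simps)
      finally show ?thesis .
    qed
    \<comment> \<open>The solution of the linearised equation with the linearised forcing \<open>q\<close> below; the factor
      \<open>t - 2 \<tau>\<close> is the resonance term.\<close>
    define l where "l t = exp (lam * t) * c +
      \<epsilon> * (t - 2 * \<tau>) * (exp (lam * (t - 2 * \<tau>)) - exp (lam * (t - \<tau>))) * c" for t
    have w_lin: "\<bar>w (3 * \<tau>) - l (3 * \<tau>)\<bar> \<le> \<eta> * K * \<bar>c\<bar>"
    proof -
      define q where "q t = \<epsilon> * (exp (lam * (t - 2 * \<tau>)) - exp (lam * (t - \<tau>))) * c" for t
      have l': "(l has_real_derivative lam * l s + q s) (at s within S)" for s S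
        unfolding l_def q_def
        by (rule derivative_eq_intros refl)+ (simp add: algebra_simps)
      have pq: "\<bar>p s - q s\<bar> \<le> 2 * \<bar>\<epsilon>\<bar> * (\<eta> * K1 * \<bar>c\<bar>)" if "s \<in> {2 * \<tau>..3 * \<tau>}" for s
      proof -
        have "p s - q s = \<epsilon> * ((v (s - 2 * \<tau>) - exp (lam * (s - 2 * \<tau>)) * c)
            - (v (s - \<tau>) - exp (lam * (s - \<tau>)) * c))"
          by (simp add: p_def q_def algebra_simps)
        moreover have "\<bar>(v (s - 2 * \<tau>) - exp (lam * (s - 2 * \<tau>)) * c)
            - (v (s - \<tau>) - exp (lam * (s - \<tau>)) * c)\<bar> \<le> 2 * (\<eta> * K1 * \<bar>c\<bar>)"
          using v_lin[of "s - 2 * \<tau>"] v_lin[of "s - \<tau>"] that \<tau> by auto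
        ultimately have "\<bar>p s - q s\<bar> \<le> \<bar>\<epsilon>\<bar> * (2 * (\<eta> * K1 * \<bar>c\<bar>))"
          by (simp only: abs_mult) (rule mult_left_mono, auto)
        then show ?thesis by simp
      qed
      have "\<bar>w (3 * \<tau>) - l (3 * \<tau>)\<bar> \<le> exp (lam * (3 * \<tau> - 2 * \<tau>)) *
          (\<bar>w (2 * \<tau>) - l (2 * \<tau>)\<bar> +
           (\<eta> * (C * \<bar>c\<bar>) + 2 * \<bar>\<epsilon>\<bar> * (\<eta> * K1 * \<bar>c\<bar>)) * (3 * \<tau> - 2 * \<tau>))"
      proof (rule linear_comparison[where r = "\<lambda>t. h (w t) + (p t - q t)" and b = "3 * \<tau>"])
        show "((\<lambda>t. w t - l t) has_real_derivative
            lam * (w s - l s) + (h (w s) + (p s - q s))) (at s within {2 * \<tau>..3 * \<tau>})"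
          if "s \<in> {2 * \<tau>..3 * \<tau>}" for s
          by (rule derivative_eq_intros w'[OF that] l' refl)+ (simp add: algebra_simps)
        show "\<bar>h (w s) + (p s - q s)\<bar> \<le> \<eta> * (C * \<bar>c\<bar>) + 2 * \<bar>\<epsilon>\<bar> * (\<eta> * K1 * \<bar>c\<bar>)"
          if "s \<in> {2 * \<tau>..3 * \<tau>}" for s
          using h[of "w s"] mult_left_mono[OF w_bd[OF that] \<eta>0] pq[OF that] by linarith
      qed (use lam \<tau> in auto)
      also have "\<dots> = e * (\<bar>w (2 * \<tau>) - l (2 * \<tau>)\<bar> +
           (\<eta> * (C * \<bar>c\<bar>) + 2 * \<bar>\<epsilon>\<bar> * (\<eta> * K1 * \<bar>c\<bar>)) * \<tau>)" by (simp add: e_def)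
      also have "\<dots> \<le> E * (\<eta> * K1 * \<bar>c\<bar> +
           (\<eta> * (C * \<bar>c\<bar>) + 2 * \<bar>\<epsilon>\<bar> * (\<eta> * K1 * \<bar>c\<bar>)) * \<tau>)"
      proof (intro mult_mono add_right_mono)
        show "\<bar>w (2 * \<tau>) - l (2 * \<tau>)\<bar> \<le> \<eta> * K1 * \<bar>c\<bar>"
          using v_lin[of "2 * \<tau>"] \<tau> by (simp add: w0 l_def)
      qed (use e E \<eta>0 pos \<tau> in auto)
      also have "\<dots> = \<eta> * K * \<bar>c\<bar>" by (simp add: K_def algebra_simps)
      finally show ?thesis .
    qed
    have l_end: "l (3 * \<tau>) = m * c"
    proof -
      have "exp (lam * (3 * \<tau> - \<tau>)) = exp (lam * \<tau>) * exp (lam * \<tau>)"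
        by (simp flip: exp_add add: algebra_simps)
      then show ?thesis by (simp add: l_def m_def algebra_simps)
    qed
    define u where "u t = (if t \<le> 2 * \<tau> then v t else w t)" for t
    have u_v: "u t = v t" if "t \<le> 2 * \<tau>" for t using that by (simp add: u_def)
    have u_w: "u t = w t" if "t \<ge> 2 * \<tau>" for t using that w0 by (cases "t = 2 * \<tau>") (auto simp: u_def)
    have "period_solution (\<lambda>x. lam * x + h x) \<epsilon> \<tau> u"
      unfolding period_solution_def
    proof (intro conjI ballI)
      fix t assume t: "t \<in> {0..2 * \<tau>}"
      have "(v has_real_derivative lam * u t + h (u t)) (at t within {0..2 * \<tau>})"
        using v'[OF t] u_v[of t] t by simp
      then show "(u has_real_derivative lam * u t + h (u t)) (at t within {0..2 * \<tau>})"
        by (rule has_field_derivative_transform_within[where d = 1]) (use t u_v in auto)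
    next
      fix t assume t: "t \<in> {2 * \<tau>..3 * \<tau>}"
      have "(w has_real_derivative lam * u t + h (u t) + \<epsilon> * (u (t - 2 * \<tau>) - u (t - \<tau>)))
          (at t within {2 * \<tau>..3 * \<tau>})"
        using w'[OF t] u_w[of t] u_v[of "t - 2 * \<tau>"] u_v[of "t - \<tau>"] t \<tau> by (simp add: p_def)
      then show "(u has_real_derivative lam * u t + h (u t) + \<epsilon> * (u (t - 2 * \<tau>) - u (t - \<tau>)))
          (at t within {2 * \<tau>..3 * \<tau>})"
        by (rule has_field_derivative_transform_within[where d = 1]) (use t u_w in auto)
    qed
    moreover have "\<bar>u t\<bar> \<le> C * \<bar>c\<bar>" if t: "t \<in> {0..3 * \<tau>}" for t
    proof (cases "t \<le> 2 * \<tau>")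
      case True
      then have "\<bar>u t\<bar> \<le> 2 * E * \<bar>c\<bar>" using v_bd[of t] t u_v by auto
      also have "\<dots> \<le> C * \<bar>c\<bar>" using EC by (rule mult_right_mono) simp
      finally show ?thesis .
    next
      case False
      then show ?thesis using w_bd[of t] t u_w by auto
    qed
    moreover have "u 0 = c" using \<tau> v0 u_v[of 0] by simp
    moreover have "\<bar>u (3 * \<tau>) - m * c\<bar> \<le> \<eta> * K * \<bar>c\<bar>"
      using w_lin l_end u_w[of "3 * \<tau>"] \<tau> by simp
    ultimately show ?thesis by blast
  qed
  moreover have "1 / (4 * \<tau> * E) > 0" using \<tau> E by simp
  ultimately show ?thesis using pos that by blast
qed

section \<open>Solutions on the half-line\<close>

lemma period_decomposition:
  fixes \<tau> t :: real
  assumes "\<tau> > 0" "3 * real N * \<tau> \<le> t"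
  obtains k s where "N \<le> k" "s \<in> {0..<3 * \<tau>}" "t = 3 * real k * \<tau> + s"
proof -
  define k where "k = nat \<lfloor>t / (3 * \<tau>)\<rfloor>"
  have "0 \<le> 3 * real N * \<tau>" using assms(1) by simp
  then have "0 \<le> t" using assms(2) by linarith
  then have "0 \<le> t / (3 * \<tau>)" using assms(1) by (intro divide_nonneg_pos) auto
  then have rk: "real k = of_int \<lfloor>t / (3 * \<tau>)\<rfloor>" by (simp add: k_def)
  have "real N \<le> t / (3 * \<tau>)" using assms by (simp add: field_simps)
  then have "N \<le> k" by (simp add: k_def le_nat_floor)
  moreover have "real k \<le> t / (3 * \<tau>)" "t / (3 * \<tau>) < real k + 1"
    unfolding rk by linarith+
  then have "t - 3 * real k * \<tau> \<in> {0..<3 * \<tau>}" using assms(1) by (simp add: field_simps)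
  ultimately show ?thesis using that[of k "t - 3 * real k * \<tau>"] by simp
qed

text \<open>
  This carries one-sided derivatives from local time \<open>S\<close> to global time \<open>A\<close>, where a joined
  solution \<open>x\<close> coincides with the shifted piece \<open>u\<close> on a single period.
\<close>

lemma has_real_derivative_time_shift:
  fixes u x :: "real \<Rightarrow> real"
  assumes "(u has_real_derivative D) (at (t - d) within S)"
    and "t \<in> A" and "\<And>s. s \<in> A \<Longrightarrow> s - d \<in> S \<and> x s = u (s - d)"
  shows "(x has_real_derivative D) (at t within A)"
proof -
  have "(u has_real_derivative D) (at (t - d) within (\<lambda>s. s - d) ` A)"
    by (rule DERIV_subset[OF assms(1)]) (use assms(3) in auto)
  moreover have "((\<lambda>s. s - d) has_real_derivative 1) (at t within A)"
    by (auto intro!: derivative_eq_intros)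
  ultimately have "(u \<circ> (\<lambda>s. s - d) has_real_derivative D * 1) (at t within A)"
    by (rule DERIV_image_chain)
  then have "(u \<circ> (\<lambda>s. s - d) has_real_derivative D) (at t within A)" by simp
  then show ?thesis
    by (rule has_field_derivative_transform_within[where d = 1]) (use assms in auto)
qed

lemma period_solution_continuous:
  assumes "period_solution f \<epsilon> \<tau> u" "\<tau> > 0"
  shows "continuous_on {0..3 * \<tau>} u"
proof -
  have "continuous_on {0..2 * \<tau>} u" "continuous_on {2 * \<tau>..3 * \<tau>} u"
    using assms(1) unfolding period_solution_def by (auto intro!: DERIV_continuous_on)
  then have "continuous_on ({0..2 * \<tau>} \<union> {2 * \<tau>..3 * \<tau>}) u"
    by (intro continuous_on_closed_Un) auto
  moreover have "{0..2 * \<tau>} \<union> {2 * \<tau>..3 * \<tau>} = {0..3 * \<tau>}" using assms(2) by auto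
  ultimately show ?thesis by simp
qed

text \<open>
  The linking condition makes the joined function well defined from both sides at the times
  \<open>3 k \<tau>\<close>, so it agrees with \<open>u k\<close> on a whole closed period; continuity and the one-sided
  derivatives at the switching times then follow from those of \<open>u k\<close>.
\<close>

lemma concatenate_period_solutions:
  fixes u :: "nat \<Rightarrow> real \<Rightarrow> real"
  assumes \<tau>: "\<tau> > 0"
    and u: "\<And>k. period_solution f \<epsilon> \<tau> (u k)"
    and link: "\<And>k. u (Suc k) 0 = u k (3 * \<tau>)"
  obtains x where "solution_on f \<epsilon> \<tau> (u 0 0) {0..} x"
    "\<And>k s. s \<in> {0..3 * \<tau>} \<Longrightarrow> x (3 * real k * \<tau> + s) = u k s"
proof -
  define n where "n t = nat \<lfloor>t / (3 * \<tau>)\<rfloor>" for t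
  define x where "x t = u (n t) (t - 3 * real (n t) * \<tau>)" for t
  have n: "n (3 * real k * \<tau> + s) = k" if "s \<in> {0..<3 * \<tau>}" for k s
  proof -
    have "(3 * real k * \<tau> + s) / (3 * \<tau>) = real k + s / (3 * \<tau>)"
      using \<tau> by (simp add: field_simps)
    moreover have "0 \<le> s / (3 * \<tau>)" "s / (3 * \<tau>) < 1" using that \<tau> by auto
    ultimately have "\<lfloor>(3 * real k * \<tau> + s) / (3 * \<tau>)\<rfloor> = int k" by linarith
    then show ?thesis by (simp add: n_def)
  qed
  have x_half: "x (3 * real k * \<tau> + s) = u k s" if "s \<in> {0..<3 * \<tau>}" for k s
    unfolding x_def n[OF that] by simp
  have x: "x (3 * real k * \<tau> + s) = u k s" if s: "s \<in> {0..3 * \<tau>}" for k s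
  proof (cases "s = 3 * \<tau>")
    case True
    have "x (3 * real (Suc k) * \<tau> + 0) = u (Suc k) 0" using \<tau> by (intro x_half) auto
    then show ?thesis using True link[of k] by (simp add: algebra_simps)
  next
    case False
    then show ?thesis using s by (intro x_half) auto
  qed
  have x': "x t = u k (t - 3 * real k * \<tau>)" if "t - 3 * real k * \<tau> \<in> {0..3 * \<tau>}" for k t
    using x[OF that, of k] by simp
  have cont_upto: "continuous_on {0..3 * real k * \<tau>} x" for k
  proof (induction k)
    case (Suc k)
    have "continuous_on {3 * real k * \<tau>..3 * real (Suc k) * \<tau>} (\<lambda>t. u k (t - 3 * real k * \<tau>))"
      by (intro continuous_on_compose2[OF period_solution_continuous[OF u \<tau>]] continuous_intros)
         (auto simp: algebra_simps)
    then have "continuous_on {3 * real k * \<tau>..3 * real (Suc k) * \<tau>} x"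
      by (rule continuous_on_eq) (rule x'[symmetric], auto simp: algebra_simps)
    with Suc have "continuous_on ({0..3 * real k * \<tau>} \<union> {3 * real k * \<tau>..3 * real (Suc k) * \<tau>}) x"
      by (intro continuous_on_closed_Un) auto
    moreover have "{0..3 * real k * \<tau>} \<union> {3 * real k * \<tau>..3 * real (Suc k) * \<tau>}
        = {0..3 * real (Suc k) * \<tau>}"
      using \<tau> by (intro ivl_disj_un_two_touch(4)) auto
    ultimately show ?case by simp
  qed simp
  have cont: "continuous_on {0..} x"
    unfolding continuous_on_eq_continuous_within
  proof
    fix t :: real assume t: "t \<in> {0..}"
    obtain k where "t / (3 * \<tau>) < real k" using reals_Archimedean2 by blast
    then have k: "t < 3 * real k * \<tau>" using \<tau> by (simp add: field_simps)
    have "at t within {0..3 * real k * \<tau>} = at t within {0..}"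
      by (rule at_within_nhd[of t "{..<3 * real k * \<tau>}"]) (use k in auto)
    moreover have "continuous (at t within {0..3 * real k * \<tau>}) x"
      using cont_upto[of k] t k by (auto simp: continuous_on_eq_continuous_within)
    ultimately show "continuous (at t within {0..}) x" by simp
  qed
  have "solution_on f \<epsilon> \<tau> (u 0 0) {0..} x"
    unfolding solution_on_def
  proof (intro conjI allI ballI)
    show "x 0 = u 0 0" using x[of 0 0] \<tau> by simp
    fix k :: nat
    show "(x has_real_derivative f (x t))
        (at t within {3 * real k * \<tau>..<(3 * real k + 2) * \<tau>} \<inter> {0..})"
      if t: "t \<in> {3 * real k * \<tau>..<(3 * real k + 2) * \<tau>} \<inter> {0..}" for t
    proof (rule has_real_derivative_time_shift[where u = "u k" and d = "3 * real k * \<tau>"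
          and S = "{0..2 * \<tau>}"])
      have "t - 3 * real k * \<tau> \<in> {0..2 * \<tau>}" using t by (auto simp: algebra_simps)
      moreover from this have "x t = u k (t - 3 * real k * \<tau>)" using \<tau> by (intro x') auto
      ultimately show "(u k has_real_derivative f (x t))
          (at (t - 3 * real k * \<tau>) within {0..2 * \<tau>})"
        using u[of k] by (simp add: period_solution_def)
      fix s assume "s \<in> {3 * real k * \<tau>..<(3 * real k + 2) * \<tau>} \<inter> {0..}"
      then have "s - 3 * real k * \<tau> \<in> {0..2 * \<tau>}" by (auto simp: algebra_simps)
      moreover from this have "x s = u k (s - 3 * real k * \<tau>)" using \<tau> by (intro x') auto
      ultimately show "s - 3 * real k * \<tau> \<in> {0..2 * \<tau>} \<and> x s = u k (s - 3 * real k * \<tau>)" ..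
    qed (rule t)
    show "(x has_real_derivative f (x t) + \<epsilon> * (x (t - 2 * \<tau>) - x (t - \<tau>)))
        (at t within {(3 * real k + 2) * \<tau>..<(3 * real k + 3) * \<tau>} \<inter> {0..})"
      if t: "t \<in> {(3 * real k + 2) * \<tau>..<(3 * real k + 3) * \<tau>} \<inter> {0..}" for t
    proof (rule has_real_derivative_time_shift[where u = "u k" and d = "3 * real k * \<tau>"
          and S = "{2 * \<tau>..3 * \<tau>}"])
      have s: "t - 3 * real k * \<tau> \<in> {2 * \<tau>..3 * \<tau>}" using t by (auto simp: algebra_simps)
      have "x t = u k (t - 3 * real k * \<tau>)" using s \<tau> by (intro x') auto
      moreover have "x (t - 2 * \<tau>) = u k (t - 3 * real k * \<tau> - 2 * \<tau>)"
        using s \<tau> x'[of "t - 2 * \<tau>" k] by (simp add: algebra_simps)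
      moreover have "x (t - \<tau>) = u k (t - 3 * real k * \<tau> - \<tau>)"
        using s \<tau> x'[of "t - \<tau>" k] by (simp add: algebra_simps)
      ultimately show "(u k has_real_derivative f (x t) + \<epsilon> * (x (t - 2 * \<tau>) - x (t - \<tau>)))
          (at (t - 3 * real k * \<tau>) within {2 * \<tau>..3 * \<tau>})"
        using u[of k] s by (simp add: period_solution_def)
      fix s assume "s \<in> {(3 * real k + 2) * \<tau>..<(3 * real k + 3) * \<tau>} \<inter> {0..}"
      then have "s - 3 * real k * \<tau> \<in> {2 * \<tau>..3 * \<tau>}" by (auto simp: algebra_simps)
      moreover from this have "x s = u k (s - 3 * real k * \<tau>)" using \<tau> by (intro x') auto
      ultimately show "s - 3 * real k * \<tau> \<in> {2 * \<tau>..3 * \<tau>} \<and> x s = u k (s - 3 * real k * \<tau>)" ..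
    qed (rule t)
  qed (rule cont)
  with x show ?thesis using that by blast
qed

lemma solution_on_subset:
  assumes "solution_on f \<epsilon> \<tau> x0 J x" "J' \<subseteq> J"
  shows "solution_on f \<epsilon> \<tau> x0 J' x"
proof -
  have "continuous_on J' x" using assms continuous_on_subset by (auto simp: solution_on_def)
  moreover have "(x has_real_derivative D) (at t within A \<inter> J')"
    if "(x has_real_derivative D) (at t within A \<inter> J)" for D t A
    by (rule DERIV_subset[OF that]) (use assms(2) in auto)
  ultimately show ?thesis
    using assms unfolding solution_on_def by (simp add: subset_iff)
qed

text \<open>
  One induction step for uniqueness. The forcing \<open>F\<close> stands for the delayed term, which is the
  same for both solutions once they agree on the past. On the half-open phase this is
  \<open>ode_unique\<close>; continuity adds the endpoint \<open>q\<close>, where the next phase starts.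
\<close>

lemma agreement_extends_over_phase:
  fixes f F x y :: "real \<Rightarrow> real"
  assumes f: "f C1_differentiable_on UNIV" and pq: "0 \<le> p" "p < q"
    and cont: "continuous_on {0..<T} x" "continuous_on {0..<T} y"
    and past: "\<And>t. t \<in> {0..p} \<inter> {0..<T} \<Longrightarrow> y t = x t"
    and x: "\<And>t. t \<in> {p..<q} \<inter> {0..<T} \<Longrightarrow>
      (x has_real_derivative f (x t) + F t) (at t within {p..<q} \<inter> {0..<T})"
    and y: "\<And>t. t \<in> {p..<q} \<inter> {0..<T} \<Longrightarrow>
      (y has_real_derivative f (y t) + F t) (at t within {p..<q} \<inter> {0..<T})"
    and t: "t \<in> {0..q} \<inter> {0..<T}"
  shows "y t = x t"
proof -
  have J: "{p..<q} \<inter> {0..<T} = {p..<min q T}" using pq by auto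
  have inner: "y s = x s" if "s \<in> {p..<min q T}" for s
  proof (rule ode_unique[OF f, of p "min q T" y F x])
    show "y p = x p" using past[of p] pq that by auto
    show "(y has_real_derivative f (y r) + F r) (at r within {p..<min q T})"
      "(x has_real_derivative f (x r) + F r) (at r within {p..<min q T})"
      if "r \<in> {p..<min q T}" for r
      using y[of r, unfolded J, OF that] x[of r, unfolded J, OF that] .
  qed (rule that)
  have "t \<le> q" using t by simp
  then consider "t \<le> p" | "p < t" "t < q" | "t = q" by linarith
  then show ?thesis
  proof cases
    case 3
    have "{p..q} \<subseteq> {0..<T}" using t 3 pq by auto
    then have "continuous_on (closure {p..<q}) (\<lambda>s. y s - x s)"
      using cont pq by (simp add: continuous_on_diff continuous_on_subset)
    moreover have "y s - x s = 0" if "s \<in> {p..<q}" for s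
      using inner[of s] that t 3 by simp
    moreover have "q \<in> closure {p..<q}" using pq by simp
    ultimately have "y q - x q = 0"
      by (rule continuous_constant_on_closure)
    then show ?thesis using 3 by simp
  next
    case 1
    then show ?thesis using past[of t] t by simp
  next
    case 2
    then show ?thesis using inner[of t] t by simp
  qed
qed

lemma solution_unique:
  assumes f: "f C1_differentiable_on UNIV" and \<tau>: "\<tau> > 0"
    and x: "solution_on f \<epsilon> \<tau> x0 {0..} x" and y: "solution_on f \<epsilon> \<tau> x0 {0..<T} y"
    and t: "t \<in> {0..<T}"
  shows "y t = x t"
proof -
  have x_T: "solution_on f \<epsilon> \<tau> x0 {0..<T} x" using x by (rule solution_on_subset) auto
  note cont = x_T[unfolded solution_on_def, THEN conjunct1] y[unfolded solution_on_def, THEN conjunct1]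
  have "\<forall>t\<in>{0..3 * real k * \<tau>} \<inter> {0..<T}. y t = x t" for k
  proof (induction k)
    case 0
    have "x 0 = x0" "y 0 = x0" using x_T y unfolding solution_on_def by blast+
    then show ?case by simp
  next
    case (Suc k)
    have mid: "y t = x t" if "t \<in> {0..(3 * real k + 2) * \<tau>} \<inter> {0..<T}" for t
    proof (rule agreement_extends_over_phase[where F = "\<lambda>_. 0", OF f _ _ cont _ _ _ that])
      show "0 \<le> 3 * real k * \<tau>" "3 * real k * \<tau> < (3 * real k + 2) * \<tau>"
        using \<tau> by (auto simp: algebra_simps)
      show "y s = x s" if "s \<in> {0..3 * real k * \<tau>} \<inter> {0..<T}" for s using Suc that by blast
      fix s assume s: "s \<in> {3 * real k * \<tau>..<(3 * real k + 2) * \<tau>} \<inter> {0..<T}"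
      show "(x has_real_derivative f (x s) + 0)
          (at s within {3 * real k * \<tau>..<(3 * real k + 2) * \<tau>} \<inter> {0..<T})"
        using x_T s unfolding solution_on_def add_0_right by blast
      show "(y has_real_derivative f (y s) + 0)
          (at s within {3 * real k * \<tau>..<(3 * real k + 2) * \<tau>} \<inter> {0..<T})"
        using y s unfolding solution_on_def add_0_right by blast
    qed
    have "y t = x t" if "t \<in> {0..(3 * real k + 3) * \<tau>} \<inter> {0..<T}" for t
    proof (rule agreement_extends_over_phase[where p = "(3 * real k + 2) * \<tau>" and
          F = "\<lambda>t. \<epsilon> * (x (t - 2 * \<tau>) - x (t - \<tau>))", OF f _ _ cont mid _ _ that])
      show "0 \<le> (3 * real k + 2) * \<tau>" "(3 * real k + 2) * \<tau> < (3 * real k + 3) * \<tau>"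
        using \<tau> by (auto simp: algebra_simps)
      fix t assume t: "t \<in> {(3 * real k + 2) * \<tau>..<(3 * real k + 3) * \<tau>} \<inter> {0..<T}"
      show "(x has_real_derivative f (x t) + \<epsilon> * (x (t - 2 * \<tau>) - x (t - \<tau>)))
          (at t within {(3 * real k + 2) * \<tau>..<(3 * real k + 3) * \<tau>} \<inter> {0..<T})"
        using x_T t unfolding solution_on_def by blast
      have "2 * \<tau> \<le> (3 * real k + 2) * \<tau>" using \<tau> by (intro mult_right_mono) auto
      moreover have "(3 * real k + 3) * \<tau> = (3 * real k + 2) * \<tau> + \<tau>"
        by (simp add: algebra_simps)
      ultimately have "t - 2 * \<tau> \<in> {0..(3 * real k + 2) * \<tau>} \<inter> {0..<T}"
        "t - \<tau> \<in> {0..(3 * real k + 2) * \<tau>} \<inter> {0..<T}"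
        using t \<tau> unfolding Int_iff atLeastAtMost_iff atLeastLessThan_iff
        by (intro conjI; linarith)+
      then have "y (t - 2 * \<tau>) = x (t - 2 * \<tau>)" "y (t - \<tau>) = x (t - \<tau>)"
        by (blast intro: mid)+
      moreover have "(y has_real_derivative f (y t) + \<epsilon> * (y (t - 2 * \<tau>) - y (t - \<tau>)))
          (at t within {(3 * real k + 2) * \<tau>..<(3 * real k + 3) * \<tau>} \<inter> {0..<T})"
        using y t unfolding solution_on_def by blast
      ultimately show "(y has_real_derivative f (y t) + \<epsilon> * (x (t - 2 * \<tau>) - x (t - \<tau>)))
          (at t within {(3 * real k + 2) * \<tau>..<(3 * real k + 3) * \<tau>} \<inter> {0..<T})"
        by simp
    qed
    moreover have eq: "3 * real (Suc k) * \<tau> = (3 * real k + 3) * \<tau>" by (simp add: algebra_simps)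
    ultimately show ?case unfolding eq by blast
  qed
  moreover obtain k where "t / (3 * \<tau>) < real k" using reals_Archimedean2 by blast
  then have "t \<in> {0..3 * real k * \<tau>} \<inter> {0..<T}" using \<tau> t by (simp add: field_simps)
  ultimately show ?thesis by blast
qed

section \<open>Asymptotic stability\<close>

text \<open>
  The decay is stated from every period start onwards: \<open>N = 0\<close> yields stability and
  \<open>N \<longlonglongrightarrow> \<infinity>\<close> yields attraction.
\<close>

lemma exponential_decay_near_equilibrium:
  fixes f :: "real \<Rightarrow> real"
  assumes f: "f C1_differentiable_on UNIV" "f xs = 0" "(f has_real_derivative lam) (at xs)"
    and lam: "lam > 0" and \<tau>: "\<tau> > 0"
    and mult: "\<bar>exp (3 * lam * \<tau>) - \<epsilon> * \<tau> * exp (lam * \<tau>) * (exp (lam * \<tau>) - 1)\<bar> < 1"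
  obtains C q \<delta> where "C > 0" "0 \<le> q" "q < 1" "\<delta> > 0"
    "\<And>x0. \<bar>x0 - xs\<bar> < \<delta> \<Longrightarrow> \<exists>x. unique_global_solution f \<epsilon> \<tau> x0 x \<and>
      (\<forall>N t. 3 * real N * \<tau> \<le> t \<longrightarrow> \<bar>x t - xs\<bar> \<le> C * q ^ N * \<bar>x0 - xs\<bar>)"
proof -
  define m where "m = exp (3 * lam * \<tau>) - \<epsilon> * \<tau> * exp (lam * \<tau>) * (exp (lam * \<tau>) - 1)"
  have m: "\<bar>m\<bar> < 1" using mult by (simp add: m_def)
  obtain C K \<eta>0 where C: "C > 0" and K: "K > 0" and \<eta>0: "\<eta>0 > 0" and period:
    "\<And>\<eta> h c. \<eta> \<le> \<eta>0 \<Longrightarrow> (\<And>x y. \<bar>h x - h y\<bar> \<le> \<eta> * \<bar>x - y\<bar>) \<Longrightarrow> h 0 = 0 \<Longrightarrow>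
      \<exists>u. u 0 = c \<and> period_solution (\<lambda>x. lam * x + h x) \<epsilon> \<tau> u \<and>
        (\<forall>t\<in>{0..3 * \<tau>}. \<bar>u t\<bar> \<le> C * \<bar>c\<bar>) \<and> \<bar>u (3 * \<tau>) - m * c\<bar> \<le> \<eta> * K * \<bar>c\<bar>"
    using perturbed_period_map[OF lam \<tau>, of \<epsilon>] unfolding m_def by blast
  \<comment> \<open>With this choice \<open>q\<close> is at most the midpoint of \<open>\<bar>m\<bar>\<close> and 1.\<close>
  define \<eta> where "\<eta> = min \<eta>0 ((1 - \<bar>m\<bar>) / (2 * K))"
  have \<eta>: "\<eta> > 0" "\<eta> \<le> \<eta>0" using \<eta>0 K m by (auto simp: \<eta>_def)
  define q where "q = \<bar>m\<bar> + \<eta> * K"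
  have "\<eta> * K \<le> (1 - \<bar>m\<bar>) / (2 * K) * K"
    using K by (intro mult_right_mono) (auto simp: \<eta>_def)
  then have "\<eta> * K \<le> (1 - \<bar>m\<bar>) / 2" using K by simp
  then have q: "0 \<le> q" "q < 1" using m \<eta> K by (auto simp: q_def)
  obtain r h where r: "r > 0" and h: "\<And>x y. \<bar>h x - h y\<bar> \<le> \<eta> * \<bar>x - y\<bar>" "h 0 = 0"
    and f_h: "\<And>x. \<bar>x\<bar> \<le> r \<Longrightarrow> f (xs + x) = lam * x + h x"
    using linearization_with_small_lipschitz_remainder[OF f \<eta>(1)] by blast
  have "\<forall>c. \<exists>u. u 0 = c \<and> period_solution (\<lambda>x. lam * x + h x) \<epsilon> \<tau> u \<and>
      (\<forall>t\<in>{0..3 * \<tau>}. \<bar>u t\<bar> \<le> C * \<bar>c\<bar>) \<and> \<bar>u (3 * \<tau>) - m * c\<bar> \<le> \<eta> * K * \<bar>c\<bar>"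
    using period[OF \<eta>(2) h] by blast
  then obtain U where U0: "\<And>c. U c 0 = c"
    and U_sol: "\<And>c. period_solution (\<lambda>x. lam * x + h x) \<epsilon> \<tau> (U c)"
    and U_bd: "\<And>c t. t \<in> {0..3 * \<tau>} \<Longrightarrow> \<bar>U c t\<bar> \<le> C * \<bar>c\<bar>"
    and U_lin: "\<And>c. \<bar>U c (3 * \<tau>) - m * c\<bar> \<le> \<eta> * K * \<bar>c\<bar>"
    by metis
  have U_end: "\<bar>U c (3 * \<tau>)\<bar> \<le> q * \<bar>c\<bar>" for c
  proof -
    have "\<bar>m * c\<bar> = \<bar>m\<bar> * \<bar>c\<bar>" by (rule abs_mult)
    then have "\<bar>U c (3 * \<tau>)\<bar> \<le> \<bar>m\<bar> * \<bar>c\<bar> + \<eta> * K * \<bar>c\<bar>" using U_lin[of c] by linarith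
    then show ?thesis by (simp add: q_def algebra_simps)
  qed
  have U_f: "period_solution f \<epsilon> \<tau> (\<lambda>t. xs + U c t)" if c: "C * \<bar>c\<bar> \<le> r" for c
  proof -
    have eq: "f (xs + U c t) = lam * U c t + h (U c t)" if "t \<in> {0..3 * \<tau>}" for t
      using U_bd[OF that, of c] c by (intro f_h) linarith
    show ?thesis
      using U_sol[of c] \<tau> unfolding period_solution_def
      by (auto simp: eq intro!: derivative_eq_intros)
  qed
  have "\<exists>x. unique_global_solution f \<epsilon> \<tau> x0 x \<and>
      (\<forall>N t. 3 * real N * \<tau> \<le> t \<longrightarrow> \<bar>x t - xs\<bar> \<le> C * q ^ N * \<bar>x0 - xs\<bar>)"
    if x0: "\<bar>x0 - xs\<bar> < r / C" for x0
  proof -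
    \<comment> \<open>The deviations from \<open>xs\<close> at the starts of the periods.\<close>
    define c where "c k = ((\<lambda>c. U c (3 * \<tau>)) ^^ k) (x0 - xs)" for k
    have c_0: "c 0 = x0 - xs" and c_Suc: "\<And>k. c (Suc k) = U (c k) (3 * \<tau>)"
      by (simp_all add: c_def)
    have c_bd: "\<bar>c k\<bar> \<le> q ^ k * \<bar>x0 - xs\<bar>" for k
    proof (induction k)
      case (Suc k)
      have "\<bar>c (Suc k)\<bar> \<le> q * \<bar>c k\<bar>" unfolding c_Suc by (rule U_end)
      also have "\<dots> \<le> q * (q ^ k * \<bar>x0 - xs\<bar>)" using Suc q by (intro mult_left_mono)
      finally show ?case by (simp add: mult.assoc)
    qed (simp add: c_0)
    have decay: "C * \<bar>c k\<bar> \<le> C * q ^ N * \<bar>x0 - xs\<bar>" if "N \<le> k" for k N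
    proof -
      have "\<bar>c k\<bar> \<le> q ^ N * \<bar>x0 - xs\<bar>"
        using c_bd[of k] mult_right_mono[OF power_decreasing[OF that q(1)], of "\<bar>x0 - xs\<bar>"] q
        by simp
      then show ?thesis using C by (simp add: mult.assoc)
    qed
    have small: "C * \<bar>c k\<bar> \<le> r" for k
    proof -
      have "C * \<bar>c k\<bar> \<le> C * \<bar>x0 - xs\<bar>" using decay[of 0 k] by simp
      also have "\<dots> \<le> r" using x0 C by (simp add: field_simps)
      finally show ?thesis .
    qed
    obtain x where sol: "solution_on f \<epsilon> \<tau> (xs + U (c 0) 0) {0..} x"
      and x: "\<And>k s. s \<in> {0..3 * \<tau>} \<Longrightarrow> x (3 * real k * \<tau> + s) = xs + U (c k) s"
      using concatenate_period_solutions[OF \<tau>, of f \<epsilon> "\<lambda>k t. xs + U (c k) t"] U_f[OF small]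
      by (auto simp: U0 c_Suc)
    have "solution_on f \<epsilon> \<tau> x0 {0..} x" using sol by (simp add: U0 c_0)
    then have "unique_global_solution f \<epsilon> \<tau> x0 x"
      unfolding unique_global_solution_def using solution_unique[OF f(1) \<tau>] by blast
    moreover have "\<bar>x t - xs\<bar> \<le> C * q ^ N * \<bar>x0 - xs\<bar>" if Nt: "3 * real N * \<tau> \<le> t" for N t
    proof -
      obtain k s where ks: "N \<le> k" "s \<in> {0..<3 * \<tau>}" "t = 3 * real k * \<tau> + s"
        by (rule period_decomposition[OF \<tau> Nt])
      have "s \<in> {0..3 * \<tau>}" using ks(2) by simp
      from x[OF this, of k] U_bd[OF this, of "c k"] have "\<bar>x t - xs\<bar> \<le> C * \<bar>c k\<bar>"
        unfolding ks(3) by linarith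
      then show ?thesis using decay[OF ks(1)] by linarith
    qed
    ultimately show ?thesis by (intro exI[of _ x] conjI allI impI)
  qed
  moreover have "r / C > 0" using r C by simp
  ultimately show ?thesis using that[OF C q] by blast
qed

theorem proposition2:
  fixes f :: "real \<Rightarrow> real" and xs lam \<epsilon> \<tau> :: real
  assumes "f C1_differentiable_on UNIV"
    and "f xs = 0"
    and "(f has_real_derivative lam) (at xs)"
    and "lam > 0"
    and "\<tau> > 0"
    and "(exp (3 * lam * \<tau>) - 1) / (\<tau> * exp (lam * \<tau>) * (exp (lam * \<tau>) - 1)) < \<epsilon>"
    and "\<epsilon> < (exp (3 * lam * \<tau>) + 1) / (\<tau> * exp (lam * \<tau>) * (exp (lam * \<tau>) - 1))"
  shows "equilibrium f \<epsilon> \<tau> xs \<and> asymptotically_stable f \<epsilon> \<tau> xs"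
proof
  show "equilibrium f \<epsilon> \<tau> xs"
    using \<open>f xs = 0\<close> by (simp add: equilibrium_def solution_on_def)
next
  have "\<tau> * exp (lam * \<tau>) * (exp (lam * \<tau>) - 1) > 0" using \<open>lam > 0\<close> \<open>\<tau> > 0\<close> by simp
  then have "\<bar>exp (3 * lam * \<tau>) - \<epsilon> * (\<tau> * exp (lam * \<tau>) * (exp (lam * \<tau>) - 1))\<bar> < 1"
    using assms(6,7) by (simp add: pos_divide_less_eq pos_less_divide_eq abs_less_iff)
  then have "\<bar>exp (3 * lam * \<tau>) - \<epsilon> * \<tau> * exp (lam * \<tau>) * (exp (lam * \<tau>) - 1)\<bar> < 1"
    by (simp only: mult.assoc)
  then obtain C q \<delta> where C: "C > 0" and q: "0 \<le> q" "q < 1" and \<delta>: "\<delta> > 0" and sol: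
    "\<And>x0. \<bar>x0 - xs\<bar> < \<delta> \<Longrightarrow> \<exists>x. unique_global_solution f \<epsilon> \<tau> x0 x \<and>
      (\<forall>N t. 3 * real N * \<tau> \<le> t \<longrightarrow> \<bar>x t - xs\<bar> \<le> C * q ^ N * \<bar>x0 - xs\<bar>)"
    using exponential_decay_near_equilibrium[OF assms(1-5)] by blast
  show "asymptotically_stable f \<epsilon> \<tau> xs"
    unfolding asymptotically_stable_def
  proof (intro conjI allI impI)
    fix \<Delta> :: real assume \<Delta>: "\<Delta> > 0"
    have "\<exists>x. unique_global_solution f \<epsilon> \<tau> x0 x \<and> (\<forall>t\<ge>0. \<bar>x t - xs\<bar> < \<Delta>)"
      if x0: "\<bar>x0 - xs\<bar> < min \<delta> (\<Delta> / C)" for x0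
    proof -
      obtain x where x: "unique_global_solution f \<epsilon> \<tau> x0 x"
        "\<And>N t. 3 * real N * \<tau> \<le> t \<Longrightarrow> \<bar>x t - xs\<bar> \<le> C * q ^ N * \<bar>x0 - xs\<bar>"
        using sol[of x0] x0 by auto
      have "\<bar>x t - xs\<bar> < \<Delta>" if "t \<ge> 0" for t
      proof -
        have "\<bar>x t - xs\<bar> \<le> C * \<bar>x0 - xs\<bar>" using x(2)[of 0 t] that by simp
        also have "\<dots> < \<Delta>"
          using x0 C by (simp add: field_simps)
        finally show ?thesis .
      qed
      with x(1) show ?thesis by blast
    qed
    then show "\<exists>\<delta>>0. \<forall>x0. \<bar>x0 - xs\<bar> < \<delta> \<longrightarrow>
        (\<exists>x. unique_global_solution f \<epsilon> \<tau> x0 x \<and> (\<forall>t\<ge>0. \<bar>x t - xs\<bar> < \<Delta>))"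
      using \<delta> \<Delta> C by (intro exI[of _ "min \<delta> (\<Delta> / C)"]) auto
  next
    have "\<exists>x. unique_global_solution f \<epsilon> \<tau> x0 x \<and> (x \<longlongrightarrow> xs) at_top"
      if x0: "\<bar>x0 - xs\<bar> < \<delta>" for x0
    proof -
      obtain x where x: "unique_global_solution f \<epsilon> \<tau> x0 x"
        "\<And>N t. 3 * real N * \<tau> \<le> t \<Longrightarrow> \<bar>x t - xs\<bar> \<le> C * q ^ N * \<bar>x0 - xs\<bar>"
        using sol[OF x0] by blast
      have "(\<lambda>N. C * q ^ N * \<bar>x0 - xs\<bar>) \<longlonglongrightarrow> C * 0 * \<bar>x0 - xs\<bar>"
        using q by (intro tendsto_intros LIMSEQ_realpow_zero)
      then have lim: "(\<lambda>N. C * q ^ N * \<bar>x0 - xs\<bar>) \<longlonglongrightarrow> 0" by simp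
      have "(x \<longlongrightarrow> xs) at_top"
      proof (rule tendstoI)
        fix e :: real assume "e > 0"
        with lim have "\<forall>\<^sub>F N in sequentially. C * q ^ N * \<bar>x0 - xs\<bar> < e"
          by (rule order_tendstoD)
        then obtain N where N: "C * q ^ N * \<bar>x0 - xs\<bar> < e"
          by (auto simp: eventually_sequentially)
        show "\<forall>\<^sub>F t in at_top. dist (x t) xs < e"
          using eventually_ge_at_top[of "3 * real N * \<tau>"]
          by eventually_elim (use x(2)[of N] N in \<open>force simp: dist_real_def\<close>)
      qed
      with x(1) show ?thesis by blast
    qed
    then show "\<exists>\<delta>'>0. \<forall>x0. \<bar>x0 - xs\<bar> < \<delta>' \<longrightarrow>
        (\<exists>x. unique_global_solution f \<epsilon> \<tau> x0 x \<and> (x \<longlongrightarrow> xs) at_top)"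
      using \<delta> by blast
  qed
qed

end
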